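(* Let $m$ and $n$ be positive integers. For integers $n\geqslant k\geqslant 0$ let $$B_{n,k}=\frac{k}{n}\binom{2n}{n-k},$$ and set $B_{m,k}=0$ for $k>m$. Then the identity $$ \sum_{k=0}^{r}B_{n,k}^2 B_{m,k}=\frac{1}{2}\binom{2n}{n}^2 \binom{2m}{m} \left[ 1-\frac{n+2m}{r}\binom{n+m}{n}^{-1}\binom{n+r}{n}^{-1}\sum_{k=0}^{r-1}\binom{s+k}{s}\binom{n+k}{n-1}\right] $$ holds for $r=m$ and $s=n$, and it also holds for $r=n$ and $s=m$.
   Context: $B_{n,k}$ are the Catalan triangle numbers; equivalently $B_{n,k}=\binom{2n-1}{n-k}-\binom{2n-1}{n-k-1}$. Binomial coefficients $\binom{x}{j}$ are zero when $j<0$ or $j>x\geqslant 0$. *)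

theory Defs
  imports Complex_Main
begin

(* The guard is essential: subtraction on nat truncates, so without it n - k would be 0 and
   the binomial coefficient 1 for k > n, instead of (2n choose a negative number) = 0. *)
definition catalan_triangle :: "nat \<Rightarrow> nat \<Rightarrow> real" where
  "catalan_triangle n k =
     (if k \<le> n then real k / real n * real ((2 * n) choose (n - k)) else 0)"

end

theory Submission
  imports Defs
begin

text \<open>
  Up to normalisation the left-hand side is
  \<open>P m = (\<Sum>k\<le>n. k^3 * (2n choose n-k)^2 * (2m choose m-k) / (2m choose m))\<close>.
  Creative telescoping in \<open>k\<close> gives a first-order inhomogeneous recurrence for \<open>P\<close> in \<open>m\<close>.
  The formula with \<open>r = m\<close>, \<open>s = n\<close> solves this recurrence, because there increasing
  \<open>m\<close> merely adds one term to the sum on the right. The formula with \<open>r = n\<close>, \<open>s = m\<close> is then the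
  symmetry in \<open>r\<close> and \<open>s\<close> of
  \<open>(\<Sum>k<r. (s+k choose s) * (n+k choose n-1)) / (r * (n+r choose n))\<close>.
\<close>

section \<open>Central binomial coefficients and their recurrences in both arguments\<close>

definition central_coeff :: "nat \<Rightarrow> nat \<Rightarrow> real" where
  "central_coeff n k = (if k \<le> n then real ((2 * n) choose (n - k)) else 0)"

lemma central_coeff_fact:
  assumes "k \<le> n"
  shows "central_coeff n k = fact (2 * n) / (fact (n - k) * fact (n + k))"
proof -
  have "2 * n - (n - k) = n + k" using assms by simp
  then show ?thesis
    using assms by (simp add: central_coeff_def binomial_fact)
qed

lemma central_coeff_0: "central_coeff n 0 = real ((2 * n) choose n)"
  by (simp add: central_coeff_def)

lemma central_coeff_0_pos: "central_coeff n 0 > 0"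
  by (simp add: central_coeff_0)

lemma central_coeff_Suc_right:
  "(real n + real k + 1) * central_coeff n (Suc k) = (real n - real k) * central_coeff n k"
proof (cases "k < n")
  case True
  then obtain d where n: "n = Suc (k + d)"
    using less_imp_Suc_add by blast
  have [simp]: "n - Suc k = d" "n - k = Suc d" using n by simp_all
  have "central_coeff n (Suc k) = fact (2 * n) / (fact d * ((real n + real k + 1) * fact (n + k)))"
    using True by (simp add: central_coeff_fact algebra_simps)
  moreover have "central_coeff n k = fact (2 * n) / ((real n - real k) * fact d * fact (n + k))"
    using True by (simp add: central_coeff_fact n algebra_simps)
  moreover have "real n + real k + 1 \<noteq> 0" "real n - real k \<noteq> 0"
    using True by linarith+
  ultimately show ?thesis by simp
qed (auto simp: central_coeff_def)

text \<open>Clearing denominators makes this valid for every \<open>k\<close>: at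
  \<open>k = Suc m\<close> the factor on the left vanishes together with
  \<open>central_coeff m k\<close>, and beyond that both coefficients are zero.\<close>

lemma central_coeff_Suc_left:
  "((real m + 1)\<^sup>2 - (real k)\<^sup>2) * central_coeff (Suc m) k =
    (2 * real m + 2) * (2 * real m + 1) * central_coeff m k"
proof (cases "k \<le> m")
  case True
  have "Suc m - k = Suc (m - k)" using True by simp
  then have "central_coeff (Suc m) k = (2 * real m + 2) * ((2 * real m + 1) * fact (2 * m)) /
      (((real m + 1 - real k) * fact (m - k)) * ((real m + 1 + real k) * fact (m + k)))"
    using True by (simp add: central_coeff_fact of_nat_diff algebra_simps)
  moreover have "real m + 1 - real k \<noteq> 0" "real m + 1 + real k \<noteq> 0"
    using True by linarith+
  moreover have "(real m + 1)\<^sup>2 - (real k)\<^sup>2 = (real m + 1 - real k) * (real m + 1 + real k)"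
    by (simp add: power2_eq_square algebra_simps)
  ultimately show ?thesis
    using True by (simp add: central_coeff_fact)
next
  case False
  then show ?thesis
    by (cases "k = Suc m") (auto simp: central_coeff_def)
qed

text \<open>For \<open>k \<le> m\<close> this is \<open>(m!)^2 / ((m-k)! (m+k)!)\<close>. Dividing
  by the central value makes the boundary term at \<open>k = 0\<close> independent of
  \<open>m\<close> and leaves only squares in the recurrence in \<open>m\<close>.\<close>

definition central_ratio :: "nat \<Rightarrow> nat \<Rightarrow> real" where
  "central_ratio m k = central_coeff m k / central_coeff m 0"

lemma central_ratio_0: "central_ratio m 0 = 1"
  using central_coeff_0_pos[of m] by (simp add: central_ratio_def)

lemma central_ratio_Suc_right:
  "(real m + real k + 1) * central_ratio m (Suc k) = (real m - real k) * central_ratio m k"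
  using central_coeff_Suc_right[of m k] by (simp add: central_ratio_def)

lemma central_ratio_Suc_left:
  "((real m + 1)\<^sup>2 - (real k)\<^sup>2) * central_ratio (Suc m) k = (real m + 1)\<^sup>2 * central_ratio m k"
proof -
  have "(real m + 1)\<^sup>2 * central_coeff (Suc m) 0 =
      (2 * real m + 2) * (2 * real m + 1) * central_coeff m 0"
    using central_coeff_Suc_left[of m 0] by simp
  then show ?thesis
    using central_coeff_Suc_left[of m k] central_coeff_0_pos[of m] central_coeff_0_pos[of "Suc m"]
    by (simp add: central_ratio_def field_simps)
qed

section \<open>Creative telescoping for the cubic moment\<close>

definition cubic_moment :: "nat \<Rightarrow> nat \<Rightarrow> real" where
  "cubic_moment n m = (\<Sum>k\<le>n. (real k)^3 * (central_coeff n k)\<^sup>2 * central_ratio m k)"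

lemma cubic_moment_0: "cubic_moment n 0 = 0"
  unfolding cubic_moment_def
  by (intro sum.neutral) (auto simp: central_ratio_def central_coeff_def)

lemma cubic_moment_Suc:
  fixes m n :: nat
  defines "M \<equiv> real m + 1"
  shows "(M + real n)\<^sup>2 * (real n + 2 * real m) * cubic_moment n (Suc m)
      - M\<^sup>2 * (real n + 2 * M) * cubic_moment n m
    = real n ^ 3 * M\<^sup>2 * (central_coeff n 0)\<^sup>2 / 2"
proof -
  define N where "N = real n"
  \<comment> \<open>The telescoping certificate. At \<open>Suc k\<close> the factors
    \<open>(N + k)^2 (M + k)\<close> become the multipliers in \<open>c1\<close> and
    \<open>w1\<close>, so \<open>H (Suc k)\<close> is a polynomial multiple of the same
    \<open>c\<^sup>2 * w\<close> as \<open>H k\<close>.\<close>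
  define H where "H k = (N * M + (N + 2 * M) * (real k * (real k - 1))) * (N + real k)\<^sup>2 * (M + real k)
      * (central_coeff n k)\<^sup>2 * central_ratio (Suc m) k" for k
  define F where "F k = (real k)^3 * (central_coeff n k)\<^sup>2 *
      ((M + N)\<^sup>2 * (N + 2 * real m) * central_ratio (Suc m) k
        - M\<^sup>2 * (N + 2 * M) * central_ratio m k)" for k
  have step: "F k = (H k - H (Suc k)) / 2" for k
  proof -
    define x c w where "x = real k" and "c = central_coeff n k" and "w = central_ratio (Suc m) k"
    have Sk: "real (Suc k) = x + 1" by (simp add: x_def)
    have c1: "(N + x + 1) * central_coeff n (Suc k) = (N - x) * c"
      using central_coeff_Suc_right[of n k] by (simp add: N_def x_def c_def)
    have w1: "(M + x + 1) * central_ratio (Suc m) (Suc k) = (M - x) * w"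
      using central_ratio_Suc_right[of "Suc m" k] by (simp add: M_def x_def w_def algebra_simps)
    have w0: "M\<^sup>2 * central_ratio m k = (M\<^sup>2 - x\<^sup>2) * w"
      using central_ratio_Suc_left[of m k] by (simp add: M_def x_def w_def)
    have "H (Suc k) = (N * M + (N + 2 * M) * ((x + 1) * x)) *
        ((N + x + 1) * central_coeff n (Suc k))\<^sup>2 * ((M + x + 1) * central_ratio (Suc m) (Suc k))"
      unfolding H_def Sk by (simp add: power_mult_distrib add.assoc)
    also have "\<dots> = (N * M + (N + 2 * M) * ((x + 1) * x)) * ((N - x) * c)\<^sup>2 * ((M - x) * w)"
      by (simp only: c1 w1)
    finally have H1: "H (Suc k) = \<dots>" .
    have H0: "H k = (N * M + (N + 2 * M) * (x * (x - 1))) * (N + x)\<^sup>2 * (M + x) * c\<^sup>2 * w"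
      by (simp add: H_def x_def c_def w_def)
    have "F k = x^3 * c\<^sup>2 * ((M + N)\<^sup>2 * (N + 2 * (M - 1)) * w
        - (N + 2 * M) * (M\<^sup>2 * central_ratio m k))"
      by (simp add: F_def M_def x_def c_def w_def algebra_simps)
    also have "\<dots> = x^3 * c\<^sup>2 * ((M + N)\<^sup>2 * (N + 2 * (M - 1)) * w
        - (N + 2 * M) * ((M\<^sup>2 - x\<^sup>2) * w))"
      by (simp only: w0)
    \<comment> \<open>The polynomial coefficient in \<open>H (Suc k)\<close> is that in
      \<open>H k\<close> with \<open>x\<close> replaced by \<open>-x\<close>, so half the difference
      is its odd part. The quadratic factor is such that the linear term of this odd part cancels,
      which matches the factor \<open>x^3\<close>.\<close>
    also have "\<dots> = (H k - H (Suc k)) / 2"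
      unfolding H0 H1 by (simp add: field_simps) algebra
    finally show ?thesis .
  qed
  have "(\<Sum>k\<le>n. F k) = (\<Sum>k\<le>n. H k - H (Suc k)) / 2"
    by (simp add: step sum_divide_distrib)
  also have "\<dots> = (H 0 - H (Suc n)) / 2"
    by (simp only: sum_telescope)
  \<comment> \<open>Only \<open>H 0\<close> survives, since
    \<open>central_coeff n (Suc n) = 0\<close>.\<close>
  also have "\<dots> = N ^ 3 * M\<^sup>2 * (central_coeff n 0)\<^sup>2 / 2"
    by (simp add: H_def central_ratio_0 central_coeff_def[of n "Suc n"] power2_eq_square power3_eq_cube)
  finally have "(\<Sum>k\<le>n. F k) = \<dots>" .
  moreover have "(\<Sum>k\<le>n. F k) = (M + N)\<^sup>2 * (N + 2 * real m) * cubic_moment n (Suc m)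
      - M\<^sup>2 * (N + 2 * M) * cubic_moment n m"
    unfolding cubic_moment_def sum_distrib_left sum_subtractf[symmetric] F_def
    by (intro sum.cong) (simp_all add: algebra_simps)
  ultimately show ?thesis by (simp add: N_def)
qed

section \<open>Solving the recurrence by a binomial sum\<close>

lemma binomial_Suc_add:
  "real (Suc m) * real ((n + Suc m) choose n) = (real n + real m + 1) * real ((n + m) choose n)"
proof -
  have "Suc m * (Suc (n + m) choose Suc m) = Suc (n + m) * ((n + m) choose m)"
    by (simp only: Suc_times_binomial_eq mult.commute)
  moreover have "Suc (n + m) choose Suc m = (n + Suc m) choose n"
    by (metis add_Suc_right add_diff_cancel_left' binomial_symmetric le_add1)
  moreover have "(n + m) choose m = (n + m) choose n"
    by (metis add_diff_cancel_left' binomial_symmetric le_add1)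
  ultimately have "Suc m * ((n + Suc m) choose n) = Suc (n + m) * ((n + m) choose n)"
    by simp
  then show ?thesis
    by (metis of_nat_mult of_nat_add of_nat_Suc add.commute)
qed

lemma binomial_add_pred:
  assumes "n > 0"
  shows "(real m + 1) * real ((n + m) choose (n - 1)) = real n * real ((n + m) choose n)"
proof -
  obtain p where n: "n = Suc p" using assms by (cases n) auto
  have "Suc p * ((n + m) choose Suc p) = ((n + m) - p) * ((n + m) choose p)"
    by (metis binomial_absorb_comp binomial_absorption mult.commute n add_Suc)
  then have "Suc p * ((n + m) choose Suc p) = Suc m * ((n + m) choose p)"
    by (simp add: n)
  then have "real (Suc p) * real ((n + m) choose Suc p) = real (Suc m) * real ((n + m) choose p)"
    by (metis of_nat_mult)
  then show ?thesis by (simp add: n algebra_simps)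
qed

text \<open>The sum in the bracket of the theorem with \<open>r\<close> and \<open>s\<close>
  decoupled, so that each can be advanced separately.\<close>

definition binomial_conv :: "nat \<Rightarrow> nat \<Rightarrow> nat \<Rightarrow> real" where
  "binomial_conv n r s = (\<Sum>k<r. real ((s + k) choose s) * real ((n + k) choose (n - 1)))"

text \<open>The case \<open>r = m\<close>, \<open>s = n\<close> with denominators cleared, so that
  the induction can start from \<open>0 = 0\<close> at \<open>m = 0\<close>. Passing to
  \<open>Suc m\<close> adds the single term \<open>E * G\<close> to the sum.\<close>

lemma cubic_moment_closed_form:
  assumes n: "n > 0"
  shows "2 * (real ((n + m) choose n))\<^sup>2 * cubic_moment n m =
    (real n)\<^sup>2 * (central_coeff n 0)\<^sup>2 *
      (real m * (real ((n + m) choose n))\<^sup>2 - (real n + 2 * real m) * binomial_conv n m n)"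
proof (induction m)
  case 0
  show ?case by (simp add: cubic_moment_0 binomial_conv_def)
next
  case (Suc m)
  define N M c E E1 G P P1 D where defs: "N = real n" "M = real m + 1" "c = central_coeff n 0"
    "E = real ((n + m) choose n)" "E1 = real ((n + Suc m) choose n)"
    "G = real ((n + m) choose (n - 1))"
    "P = cubic_moment n m" "P1 = cubic_moment n (Suc m)" "D = binomial_conv n m n"
  have pos: "M > 0" "N > 0" "E > 0" "N + 2 * (M - 1) > 0"
    using n by (simp_all add: defs)
  have E1: "E1 = (N + M) * E / M"
    using binomial_Suc_add[of m n] pos by (simp add: defs field_simps)
  have G: "G = N * E / M"
    using binomial_add_pred[OF n, of m] pos by (simp add: defs field_simps)
  have D1: "binomial_conv n (Suc m) n = D + E * G"
    by (simp add: binomial_conv_def defs)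
  have IH: "2 * E\<^sup>2 * P = N\<^sup>2 * c\<^sup>2 * ((M - 1) * E\<^sup>2 - (N + 2 * (M - 1)) * D)"
    using Suc.IH by (simp add: defs)
  have rec: "(M + N)\<^sup>2 * (N + 2 * (M - 1)) * P1 = M\<^sup>2 * (N + 2 * M) * P + N ^ 3 * M\<^sup>2 * c\<^sup>2 / 2"
    using cubic_moment_Suc[of m n] by (simp add: defs)
  have "(N + 2 * (M - 1)) * (2 * E1\<^sup>2 * P1) * M\<^sup>2
      = 2 * E\<^sup>2 * ((M + N)\<^sup>2 * (N + 2 * (M - 1)) * P1)"
    using pos by (simp add: E1 power_divide power_mult_distrib add.commute)
  also have "\<dots> = M\<^sup>2 * (N + 2 * M) * (2 * E\<^sup>2 * P) + E\<^sup>2 * N ^ 3 * M\<^sup>2 * c\<^sup>2"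
    unfolding rec by (simp add: algebra_simps)
  \<comment> \<open>The inhomogeneous term makes \<open>n + 2m\<close> a common factor:
    \<open>(N + 2M)(M - 1) + N = M (N + 2(M - 1))\<close>. It is positive and cancels at the
    end.\<close>
  also have "\<dots> = (N + 2 * (M - 1)) *
      (N\<^sup>2 * c\<^sup>2 * (M * ((N + M) * E)\<^sup>2 - (N + 2 * M) * (M\<^sup>2 * D + M * N * E\<^sup>2)))"
    unfolding IH by algebra
  also have "\<dots> = (N + 2 * (M - 1)) *
      (N\<^sup>2 * c\<^sup>2 * (M * E1\<^sup>2 - (N + 2 * M) * (D + E * G))) * M\<^sup>2"
    using pos by (simp add: E1 G field_simps power2_eq_square)
  finally have "2 * E1\<^sup>2 * P1 = N\<^sup>2 * c\<^sup>2 * (M * E1\<^sup>2 - (N + 2 * M) * (D + E * G))"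
    using pos by simp
  then show ?case
    unfolding D1 by (simp add: defs add.commute)
qed

section \<open>Symmetry of the normalised binomial sum in \<open>r\<close> and
  \<open>s\<close>\<close>

lemma binomial_conv_Suc_right:
  assumes n: "n > 0"
  shows "real (Suc s) * real ((n + Suc s) choose n) * binomial_conv n r (Suc s)
      - real s * real ((n + s) choose n) * binomial_conv n r s
    = real r * real ((n + r) choose n) * real ((r + s) choose r) * real ((n + s) choose (n - 1))"
proof (induction r)
  case 0
  show ?case by (simp add: binomial_conv_def)
next
  case (Suc r)
  define N R S where NRS: "N = real n" "R = real r + 1" "S = real s + 1"
  define b where "b = real ((s + r) choose s)"
  define Er Es where E: "Er = real ((n + r) choose n)" "Es = real ((n + s) choose n)"
  have pos: "R > 0" "S > 0" by (simp_all add: NRS)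
  have of_nats: "real r = R - 1" "real s = S - 1" "real n = N" "real (Suc r) = R" "real (Suc s) = S"
    by (simp_all add: NRS)
  have b0: "real ((r + s) choose r) = b"
    by (metis b_def add.commute add_diff_cancel_left' binomial_symmetric le_add1)
  have b1: "real ((Suc s + r) choose Suc s) = (R + S - 1) * b / S"
  proof -
    have "Suc s * ((Suc s + r) choose Suc s) = (Suc s + r) * ((s + r) choose s)"
      by (metis Suc_times_binomial_eq add_Suc mult.commute)
    then have "S * real ((Suc s + r) choose Suc s) = (R + S - 1) * b"
      unfolding b_def using of_nats(1,5) by (metis (no_types) of_nat_mult of_nat_add add.commute add_diff_eq)
    then show ?thesis using pos by (simp add: field_simps)
  qed
  have b2: "real ((Suc r + s) choose Suc r) = (R + S - 1) * b / R"
  proof -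
    have "(Suc r + s) choose Suc r = (s + Suc r) choose s"
      by (metis add.commute add_diff_cancel_left' binomial_symmetric le_add1)
    then have "R * real ((Suc r + s) choose Suc r) = (R + S - 1) * b"
      using binomial_Suc_add[of r s] by (simp add: b_def NRS add_ac)
    then show ?thesis using pos by (simp add: field_simps)
  qed
  have Er1: "real ((n + Suc r) choose n) = (N + R) * Er / R"
    using binomial_Suc_add[of r n] pos by (simp add: E NRS field_simps)
  have Es1: "real ((n + Suc s) choose n) = (N + S) * Es / S"
    using binomial_Suc_add[of s n] pos by (simp add: E NRS field_simps)
  have Gr: "real ((n + r) choose (n - 1)) = N * Er / R"
    using binomial_add_pred[OF n, of r] pos by (simp add: E NRS field_simps)
  have Gs: "real ((n + s) choose (n - 1)) = N * Es / S"
    using binomial_add_pred[OF n, of s] pos by (simp add: E NRS field_simps)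
  \<comment> \<open>The gains of the two sides of the claim from \<open>r\<close> to
    \<open>Suc r\<close> agree, once every binomial is written as a rational multiple of
    \<open>b\<close>, \<open>Er\<close> or \<open>Es\<close>.\<close>
  have "S * ((N + S) * Es / S) * ((R + S - 1) * b / S * (N * Er / R))
      - (S - 1) * Es * (b * (N * Er / R))
    = R * ((N + R) * Er / R) * ((R + S - 1) * b / R) * (N * Es / S)
      - (R - 1) * Er * b * (N * Es / S)"
    using pos by (simp add: field_simps)
  moreover have "S * ((N + S) * Es / S) * binomial_conv n r (Suc s) - (S - 1) * Es * binomial_conv n r s
      = (R - 1) * Er * b * (N * Es / S)"
    using Suc.IH unfolding b0 Es1 Gs E[symmetric] of_nats .
  moreover have "binomial_conv n (Suc r) (Suc s) = binomial_conv n r (Suc s) + (R + S - 1) * b / S * (N * Er / R)"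
    unfolding binomial_conv_def sum.lessThan_Suc b1 Gr ..
  moreover have "binomial_conv n (Suc r) s = binomial_conv n r s + b * (N * Er / R)"
    unfolding binomial_conv_def sum.lessThan_Suc Gr b_def ..
  ultimately show ?case
    unfolding b2 Er1 Es1 Gs E[symmetric] of_nats by (simp only: distrib_left)
qed

text \<open>Both sides vanish at \<open>s = 0\<close>. From \<open>s\<close> to \<open>Suc s\<close>
  the right side gains one summand, and \<open>binomial_conv_Suc_right\<close> shows that the left
  side gains the same amount.\<close>

lemma binomial_conv_symmetric:
  assumes "n > 0"
  shows "real s * real ((n + s) choose n) * binomial_conv n r s =
    real r * real ((n + r) choose n) * binomial_conv n s r"
proof (induction s)
  case 0
  show ?case by (simp add: binomial_conv_def)
next
  case (Suc s)
  have "binomial_conv n (Suc s) r = binomial_conv n s r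
      + real ((r + s) choose r) * real ((n + s) choose (n - 1))"
    by (simp add: binomial_conv_def)
  then show ?case
    using Suc.IH binomial_conv_Suc_right[OF assms, of s r] by (simp add: algebra_simps)
qed

section \<open>Passage from Catalan triangle numbers to the cubic moment\<close>

lemma catalan_triangle_central_coeff:
  "n > 0 \<Longrightarrow> catalan_triangle n k = real k / real n * central_coeff n k"
  by (simp add: catalan_triangle_def central_coeff_def)

text \<open>The upper limits \<open>m\<close> and \<open>n\<close> are interchangeable because terms
  with \<open>k > m\<close> or \<open>k > n\<close> vanish. The three prefactors of the triangle
  numbers supply the cube of \<open>k\<close>.\<close>

lemma sum_catalan_triangle:
  assumes "m > 0" "n > 0" "r = m \<or> r = n"
  shows "(\<Sum>k=0..r. (catalan_triangle n k)\<^sup>2 * catalan_triangle m k) =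
    central_coeff m 0 / ((real n)\<^sup>2 * real m) * cubic_moment n m"
proof -
  have "(\<Sum>k=0..r. (catalan_triangle n k)\<^sup>2 * catalan_triangle m k) =
      (\<Sum>k\<le>n. (catalan_triangle n k)\<^sup>2 * catalan_triangle m k)"
    by (rule sum.mono_neutral_cong) (use assms(3) in \<open>auto simp: catalan_triangle_def\<close>)
  also have "\<dots> = central_coeff m 0 / ((real n)\<^sup>2 * real m) * cubic_moment n m"
    unfolding cubic_moment_def sum_distrib_left
    using assms(1,2) central_coeff_0_pos[of m]
    by (intro sum.cong)
      (simp_all add: catalan_triangle_central_coeff central_ratio_def power2_eq_square
        power3_eq_cube)
  finally show ?thesis .
qed

theorem theorem1p2:
  fixes m n r s :: nat
  assumes "m > 0" and "n > 0"
    and "(r = m \<and> s = n) \<or> (r = n \<and> s = m)"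
  shows "(\<Sum>k=0..r. (catalan_triangle n k)\<^sup>2 * catalan_triangle m k) =
    1 / 2 * (real ((2 * n) choose n))\<^sup>2 * real ((2 * m) choose m) *
    (1 - (real n + 2 * real m) / real r
         * inverse (real ((n + m) choose n)) * inverse (real ((n + r) choose n))
         * (\<Sum>k=0..r - 1. real ((s + k) choose s) * real ((n + k) choose (n - 1))))"
proof -
  define E where "E = real ((n + m) choose n)"
  define Er where "Er = real ((n + r) choose n)"
  have r: "r > 0" "r = m \<or> r = n" using assms by auto
  have pos: "E > 0" "Er > 0" by (simp_all add: E_def Er_def)
  \<comment> \<open>Positivity of \<open>r\<close> matters: with truncated subtraction the left
    interval would contain \<open>0\<close> when \<open>r = 0\<close>.\<close>
  have "{0..r - 1} = {..<r}" using r by auto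
  then have conv: "(\<Sum>k=0..r - 1. real ((s + k) choose s) * real ((n + k) choose (n - 1)))
      = binomial_conv n r s"
    by (simp add: binomial_conv_def)
  \<comment> \<open>Trivial for \<open>r = m\<close>; for \<open>r = n\<close> this is the symmetry,
    which transfers the closed form to the second choice of \<open>r\<close> and
    \<open>s\<close>.\<close>
  have "real m * E * binomial_conv n r s = real r * Er * binomial_conv n m n"
    using assms(3) binomial_conv_symmetric[OF assms(2), of m n] by (auto simp: E_def Er_def)
  then have D: "binomial_conv n m n = real m * E * binomial_conv n r s / (real r * Er)"
    using r pos by simp
  have "cubic_moment n m = (real n)\<^sup>2 * (central_coeff n 0)\<^sup>2 *
      (real m * E\<^sup>2 - (real n + 2 * real m) * binomial_conv n m n) / (2 * E\<^sup>2)"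
    using cubic_moment_closed_form[OF assms(2), of m] pos unfolding E_def
    by (simp add: field_simps)
  also have "\<dots> = (real n)\<^sup>2 * real m * (1 / 2 * (central_coeff n 0)\<^sup>2 *
      (1 - (real n + 2 * real m) / real r * inverse E * inverse Er * binomial_conv n r s))"
    unfolding D using r pos by (simp add: field_simps power2_eq_square)
  finally have cm: "cubic_moment n m = \<dots>" .
  have "central_coeff m 0 / ((real n)\<^sup>2 * real m) * cubic_moment n m =
      1 / 2 * (central_coeff n 0)\<^sup>2 * central_coeff m 0 *
      (1 - (real n + 2 * real m) / real r * inverse E * inverse Er * binomial_conv n r s)"
    unfolding cm using assms(1,2) by simp
  then show ?thesis
    unfolding sum_catalan_triangle[OF assms(1,2) r(2)] conv central_coeff_0 E_def Er_def .
qed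

end
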